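(* Let $N\ge 2$, $W>0$, $\eta>0$, let $\tilde F_{\max}^{(1)}$ and $\tilde P_{\mathrm{out}}^{(1)}$ be the rank-1 quantities defined in the context, and let $c_1 = \max_{1\le n\le N}|u_{n,1}|^2$. Then for every $x\ge 0$, $$\tilde F_{\max}^{(1)}(x) = 1-e^{-x/(\lambda_1c_1)},$$ and for all $\gamma_{\mathrm{th}}>0$, $\bar\gamma>0$, $$\tilde P_{\mathrm{out}}^{(1)} = 1-\exp\!\left(-\frac{\gamma_{\mathrm{th}}}{\bar\gamma\lambda_1c_1}\right).$$
   Context: $\mathbf{R}$ is the $N\times N$ real symmetric positive semidefinite Toeplitz matrix (Jakes correlation matrix) with entries $[\mathbf{R}]_{k,l} = J_0\!\left(\frac{2\pi |k-l| W}{N-1}\right)$, where $J_0$ is the zeroth-order Bessel function of the first kind. Fix an eigendecomposition $\mathbf{R} = \mathbf{U}\boldsymbol{\Lambda}\mathbf{U}^H$ with $\mathbf{U}$ unitary with entries $u_{n,k}$ and $\boldsymbol{\Lambda}=\mathrm{diag}(\lambda_1,\dots,\lambda_N)$, $\lambda_1\ge\cdots\ge\lambda_N\ge 0$. Let $z_1\sim\mathcal{CN}(0,1)$ (standard circularly symmetric complex Gaussian). The rank-1 truncated channel is $\tilde g_n^{(1)} = \sqrt{\eta\lambda_1}\,u_{n,1}z_1$, $n=1,\dots,N$. Define $\tilde F_{\max}^{(1)}(x) = \mathbb{P}(\max_{1\le n\le N}|\tilde g_n^{(1)}|^2/\eta\le x)$ and, for an SNR threshold $\gamma_{\mathrm{th}}$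 and average SNR $\bar\gamma$, $\tilde P_{\mathrm{out}}^{(1)}=\tilde F_{\max}^{(1)}(\gamma_{\mathrm{th}}/\bar\gamma)$. *)

theory Defs
  imports "HOL-Probability.Probability" "Jordan_Normal_Form.Schur_Decomposition"
begin

text \<open>Bessel function of the first kind of order zero, by its everywhere convergent power series.\<close>

definition bessel_J0 :: "real \<Rightarrow> real" where
  "bessel_J0 x = (\<Sum>m. (-1) ^ m / (fact m)\<^sup>2 * (x / 2) ^ (2 * m))"

text \<open>Row and column indices of matrices run over \<open>0, \<dots>, N - 1\<close> instead of \<open>1, \<dots>, N\<close>;
  in particular \<open>lam 0\<close> below is the largest eigenvalue and column \<open>0\<close> of \<open>U\<close> is the
  leading eigenvector.\<close>

definition jakes_matrix :: "nat \<Rightarrow> real \<Rightarrow> real mat" where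
  "jakes_matrix N W =
     mat N N (\<lambda>(k, l). bessel_J0 (2 * pi * \<bar>real k - real l\<bar> * W / (real N - 1)))"

definition unitary_matrix :: "nat \<Rightarrow> complex mat \<Rightarrow> bool" where
  "unitary_matrix N U \<longleftrightarrow>
     U \<in> carrier_mat N N \<and> mat_adjoint U * U = 1\<^sub>m N \<and> U * mat_adjoint U = 1\<^sub>m N"

definition ordered_eigendecomposition ::
  "nat \<Rightarrow> real mat \<Rightarrow> complex mat \<Rightarrow> (nat \<Rightarrow> real) \<Rightarrow> bool" where
  "ordered_eigendecomposition N R U lam \<longleftrightarrow>
     unitary_matrix N U \<and>
     map_mat complex_of_real R = U * mat_diag N (\<lambda>i. complex_of_real (lam i)) * mat_adjoint U \<and>
     (\<forall>i j. i \<le> j \<longrightarrow> j < N \<longrightarrow> lam j \<le> lam i) \<and>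
     (\<forall>i<N. 0 \<le> lam i)"

text \<open>The distribution \<open>CN(0,1)\<close>: independent real and imaginary parts, each normal with
  mean \<open>0\<close> and variance \<open>1/2\<close> (the second parameter of \<^const>\<open>normal_density\<close> is the
  standard deviation).\<close>

definition std_complex_gaussian :: "'a measure \<Rightarrow> ('a \<Rightarrow> complex) \<Rightarrow> bool" where
  "std_complex_gaussian M z \<longleftrightarrow>
     prob_space.indep_var M borel (\<lambda>\<omega>. Re (z \<omega>)) borel (\<lambda>\<omega>. Im (z \<omega>)) \<and>
     distributed M lborel (\<lambda>\<omega>. Re (z \<omega>)) (normal_density 0 (sqrt (1 / 2))) \<and>
     distributed M lborel (\<lambda>\<omega>. Im (z \<omega>)) (normal_density 0 (sqrt (1 / 2)))"

definition rank1_channel ::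
  "real \<Rightarrow> (nat \<Rightarrow> real) \<Rightarrow> complex mat \<Rightarrow> ('a \<Rightarrow> complex) \<Rightarrow> nat \<Rightarrow> 'a \<Rightarrow> complex" where
  "rank1_channel \<eta> lam U z n \<omega> = complex_of_real (sqrt (\<eta> * lam 0)) * U $$ (n, 0) * z \<omega>"

definition rank1_F_max ::
  "'a measure \<Rightarrow> nat \<Rightarrow> real \<Rightarrow> (nat \<Rightarrow> real) \<Rightarrow> complex mat \<Rightarrow> ('a \<Rightarrow> complex) \<Rightarrow> real \<Rightarrow> real"
where
  "rank1_F_max M N \<eta> lam U z x =
     measure M {\<omega> \<in> space M. (MAX n\<in>{..<N}. (cmod (rank1_channel \<eta> lam U z n \<omega>))\<^sup>2 / \<eta>) \<le> x}"

definition rank1_P_out ::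
  "'a measure \<Rightarrow> nat \<Rightarrow> real \<Rightarrow> (nat \<Rightarrow> real) \<Rightarrow> complex mat \<Rightarrow> ('a \<Rightarrow> complex) \<Rightarrow>
     real \<Rightarrow> real \<Rightarrow> real"
where
  "rank1_P_out M N \<eta> lam U z \<gamma>_th \<gamma>_avg = rank1_F_max M N \<eta> lam U z (\<gamma>_th / \<gamma>_avg)"

end

theory Submission
  imports Defs "HOL-Real_Asymp.Real_Asymp"
begin

text \<open>
  Both \<open>lam 0\<close> and \<open>c1\<close> are positive: the correlation matrix is nonzero since
  \<open>J\<^sub>0(0) = 1\<close>, and a column of a unitary matrix cannot vanish. Hence the event
  \<open>max |g\<^sub>n|\<^sup>2 / \<eta> \<le> x\<close> is the event \<open>|z1|\<^sup>2 \<le> x / (lam 0 * c1)\<close>, and everything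
  rests on \<open>P(|z1|\<^sup>2 > t) = exp (- t)\<close>. Instead of polar coordinates we write
  \<open>exp (- |p|\<^sup>2)\<close> as the integral of \<open>exp (- s)\<close> over \<open>s \<ge> |p|\<^sup>2\<close>. Exchanging the
  integrals turns the tail into the integral of \<open>exp (- s)\<close> against the area \<open>pi * (s - t)\<close>
  of an annulus.
\<close>

text \<open>The norm on \<open>real \<times> real\<close> is Euclidean, so for
  \<open>t \<le> s\<close> the set is the closed disc of squared radius \<open>s\<close> minus that
  of squared radius \<open>t\<close>. For \<open>s < t\<close> it is empty, which the indicator
  records.\<close>

lemma emeasure_annulus:
  assumes "0 \<le> t"
  shows "emeasure lborel {p :: real \<times> real. t < (norm p)\<^sup>2 \<and> (norm p)\<^sup>2 \<le> s} =
    ennreal (pi * (s - t)) * indicator {t..} s"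
proof (cases "t \<le> s")
  case True
  have cball: "{p :: real \<times> real. (norm p)\<^sup>2 \<le> r} = cball 0 (sqrt r)" if "0 \<le> r" for r
  proof -
    have "(norm p)\<^sup>2 \<le> r \<longleftrightarrow> norm p \<le> sqrt r" for p :: "real \<times> real"
      using that real_sqrt_le_iff[of "(norm p)\<^sup>2" r] by simp
    then show ?thesis by (auto simp: cball_def)
  qed
  have area: "emeasure lborel (cball (0 :: real \<times> real) (sqrt r)) = ennreal (pi * r)" if "0 \<le> r" for r
    \<comment> \<open>The instance 1 of the even-dimensional formula is dimension 2, where the unit
      ball has volume \<open>pi\<close>.\<close>
    using that unit_ball_vol_even[of 1] by (simp add: emeasure_cball)
  have "{p :: real \<times> real. t < (norm p)\<^sup>2 \<and> (norm p)\<^sup>2 \<le> s} = cball 0 (sqrt s) - cball 0 (sqrt t)"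
  proof -
    have "{p :: real \<times> real. t < (norm p)\<^sup>2 \<and> (norm p)\<^sup>2 \<le> s} =
        {p. (norm p)\<^sup>2 \<le> s} - {p. (norm p)\<^sup>2 \<le> t}"
      by auto
    then show ?thesis using cball[of s] cball[of t] True assms by simp
  qed
  also have "emeasure lborel \<dots> = ennreal (pi * s) - ennreal (pi * t)"
    using True assms by (subst emeasure_Diff) (auto simp: area intro!: subset_cball)
  finally show ?thesis
    using True assms by (simp add: ennreal_minus right_diff_distrib)
next
  case False
  then have empty: "{p :: real \<times> real. t < (norm p)\<^sup>2 \<and> (norm p)\<^sup>2 \<le> s} = {}" by auto
  show ?thesis unfolding empty using False by simp
qed

lemma nn_integral_exp_neg_atLeast:
  fixes a :: real
  shows "(\<integral>\<^sup>+s. ennreal (exp (- s)) * indicator {a..} s \<partial>lborel) = ennreal (exp (- a))"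
proof -
  have "((\<lambda>s. - exp (- s)) \<longlongrightarrow> (0::real)) at_top" by real_asymp
  then have "(\<integral>\<^sup>+s. ennreal (exp (- s)) * indicator {a..} s \<partial>lborel) = ennreal (0 - (- exp (- a)))"
    by (intro nn_integral_FTC_atLeast) (auto intro!: derivative_eq_intros)
  then show ?thesis by simp
qed

lemma nn_integral_linear_exp_neg_atLeast:
  fixes t :: real
  shows "(\<integral>\<^sup>+s. ennreal ((s - t) * exp (- s)) * indicator {t..} s \<partial>lborel) = ennreal (exp (- t))"
proof -
  \<comment> \<open>The function under the limit is an antiderivative of
    \<open>(s - t) * exp (- s)\<close>, found by parts; at \<open>s = t\<close> it equals
    \<open>- exp (- t)\<close>.\<close>
  have "((\<lambda>s. - ((s - t + 1) * exp (- s))) \<longlongrightarrow> 0) at_top" by real_asymp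
  then have "(\<integral>\<^sup>+s. ennreal ((s - t) * exp (- s)) * indicator {t..} s \<partial>lborel) =
      ennreal (0 - (- ((t - t + 1) * exp (- t))))"
    by (intro nn_integral_FTC_atLeast) (auto intro!: derivative_eq_intros simp: algebra_simps)
  then show ?thesis by simp
qed

lemma nn_integral_exp_neg_norm_square_tail:
  assumes "0 \<le> t"
  shows "(\<integral>\<^sup>+p. ennreal (exp (- (norm p)\<^sup>2)) * indicator {p :: real \<times> real. t < (norm p)\<^sup>2} p \<partial>lborel) =
    ennreal (pi * exp (- t))" (is "?L = _")
proof -
  let ?A = "\<lambda>s. {p :: real \<times> real. t < (norm p)\<^sup>2 \<and> (norm p)\<^sup>2 \<le> s}"
  have "?L = (\<integral>\<^sup>+p. \<integral>\<^sup>+s. ennreal (exp (- s)) * indicator (?A s) p \<partial>lborel \<partial>lborel)"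
  proof (rule nn_integral_cong)
    fix p :: "real \<times> real"
    \<comment> \<open>The condition \<open>t < (norm p)\<^sup>2\<close> does not involve
      \<open>s\<close>, so its indicator leaves the inner integral as a constant factor.\<close>
    have "(\<integral>\<^sup>+s. ennreal (exp (- s)) * indicator (?A s) p \<partial>lborel) =
        (\<integral>\<^sup>+s. ennreal (exp (- s)) * indicator {(norm p)\<^sup>2..} s * indicator {p. t < (norm p)\<^sup>2} p \<partial>lborel)"
      by (intro nn_integral_cong) (auto simp: indicator_def)
    also have "\<dots> = ennreal (exp (- (norm p)\<^sup>2)) * indicator {p. t < (norm p)\<^sup>2} p"
      by (subst nn_integral_multc) (auto simp: nn_integral_exp_neg_atLeast)
    finally show "ennreal (exp (- (norm p)\<^sup>2)) * indicator {p. t < (norm p)\<^sup>2} p =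
        (\<integral>\<^sup>+s. ennreal (exp (- s)) * indicator (?A s) p \<partial>lborel)" ..
  qed
  also have "\<dots> = (\<integral>\<^sup>+s. \<integral>\<^sup>+p. ennreal (exp (- s)) * indicator (?A s) p \<partial>lborel \<partial>lborel)"
  proof (rule lborel_pair.Fubini')
    \<comment> \<open>Joint measurability: the sets \<open>?A s\<close> become sections of one
      subset of the product space, cut out by measurable inequalities.\<close>
    have "(\<lambda>(s, p). ennreal (exp (- s)) * indicator (?A s) p) =
        (\<lambda>x. ennreal (exp (- fst x)) *
          indicator {x \<in> space (lborel \<Otimes>\<^sub>M lborel). t < (norm (snd x))\<^sup>2 \<and> (norm (snd x))\<^sup>2 \<le> fst x} x)"
      by (auto simp: fun_eq_iff indicator_def space_pair_measure)
    also have "\<dots> \<in> borel_measurable (lborel \<Otimes>\<^sub>M lborel)" by measurable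
    finally show "(\<lambda>(s, p). ennreal (exp (- s)) * indicator (?A s) p)
        \<in> borel_measurable (lborel \<Otimes>\<^sub>M lborel)" .
  qed
  also have "\<dots> = (\<integral>\<^sup>+s. ennreal pi * (ennreal ((s - t) * exp (- s)) * indicator {t..} s) \<partial>lborel)"
    \<comment> \<open>For fixed \<open>s\<close> the weight \<open>exp (- s)\<close> is constant in
      \<open>p\<close>, so the inner integral is this weight times the area of the annulus.\<close>
    by (intro nn_integral_cong, subst nn_integral_cmult_indicator)
      (auto simp: emeasure_annulus[OF assms] indicator_def ennreal_mult' [symmetric] mult_ac)
  also have "\<dots> = ennreal (pi * exp (- t))"
    by (subst nn_integral_cmult) (auto simp: nn_integral_linear_exp_neg_atLeast ennreal_mult)
  finally show ?thesis .
qed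

text \<open>By independence the pair of real and imaginary parts has a product density, which is the
  radial function \<open>exp (- (norm p)\<^sup>2) / pi\<close>. The factor \<open>1 / pi\<close>
  cancels the \<open>pi\<close> of the planar tail integral.\<close>

lemma std_complex_gaussian_cmod_square_tail:
  assumes "prob_space M" and z: "std_complex_gaussian M z" and t: "0 \<le> t"
  shows "measure M {\<omega> \<in> space M. t < (cmod (z \<omega>))\<^sup>2} = exp (- t)"
proof -
  interpret prob_space M by fact
  have indep: "indep_var borel (\<lambda>\<omega>. Re (z \<omega>)) borel (\<lambda>\<omega>. Im (z \<omega>))"
    and Re: "distributed M lborel (\<lambda>\<omega>. Re (z \<omega>)) (normal_density 0 (sqrt (1 / 2)))"
    and Im: "distributed M lborel (\<lambda>\<omega>. Im (z \<omega>)) (normal_density 0 (sqrt (1 / 2)))"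
    using z by (auto simp: std_complex_gaussian_def)
  \<comment> \<open>The joint density rule asks for independence with \<open>lborel\<close> as
    target; composing with \<open>id\<close> switches to it, as it has the same measurable sets as
    \<open>borel\<close>.\<close>
  have "indep_var lborel (\<lambda>\<omega>. Re (z \<omega>)) lborel (\<lambda>\<omega>. Im (z \<omega>))"
    using indep_var_compose[OF indep, of id lborel id lborel] by (simp add: comp_def)
  from distributed_joint_indep[OF sigma_finite_lborel sigma_finite_lborel Re Im this]
  have joint: "distributed M lborel (\<lambda>\<omega>. (Re (z \<omega>), Im (z \<omega>)))
      (\<lambda>(x, y). ennreal (normal_density 0 (sqrt (1 / 2)) x) * ennreal (normal_density 0 (sqrt (1 / 2)) y))"
    by (simp add: lborel_prod)
  let ?T = "{p :: real \<times> real. t < (norm p)\<^sup>2}"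
  have T: "?T \<in> sets lborel" by measurable
  have "{\<omega> \<in> space M. t < (cmod (z \<omega>))\<^sup>2} = (\<lambda>\<omega>. (Re (z \<omega>), Im (z \<omega>))) -` ?T \<inter> space M"
    by (auto simp: norm_prod_def cmod_def)
  then have "emeasure M {\<omega> \<in> space M. t < (cmod (z \<omega>))\<^sup>2} =
      (\<integral>\<^sup>+p. (case p of (x, y) \<Rightarrow> ennreal (normal_density 0 (sqrt (1 / 2)) x) *
        ennreal (normal_density 0 (sqrt (1 / 2)) y)) * indicator ?T p \<partial>lborel)"
    using distributed_emeasure[OF joint T] by simp
  also have "\<dots> = (\<integral>\<^sup>+p. ennreal (1 / pi) * (ennreal (exp (- (norm p)\<^sup>2)) * indicator ?T p) \<partial>lborel)"
  proof (rule nn_integral_cong)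
    fix p :: "real \<times> real"
    obtain x y where p: "p = (x, y)" by (cases p)
    \<comment> \<open>With variance 1/2 each marginal density is
      \<open>exp (- x\<^sup>2) / sqrt pi\<close>.\<close>
    have half_sd: "(1 / sqrt 2)\<^sup>2 = (1 / 2 :: real)"
      by (simp add: power_one_over)
    have "normal_density 0 (sqrt (1 / 2)) x * normal_density 0 (sqrt (1 / 2)) y
        = 1 / pi * exp (- (norm p)\<^sup>2)"
      by (simp add: p normal_density_def norm_prod_def mult_exp_exp real_sqrt_divide half_sd)
    then show "(case p of (x, y) \<Rightarrow> ennreal (normal_density 0 (sqrt (1 / 2)) x) *
          ennreal (normal_density 0 (sqrt (1 / 2)) y)) * indicator ?T p =
        ennreal (1 / pi) * (ennreal (exp (- (norm p)\<^sup>2)) * indicator ?T p)"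
      by (simp add: p ennreal_mult' [symmetric] mult.assoc [symmetric])
  qed
  also have "\<dots> = ennreal (exp (- t))"
    using nn_integral_exp_neg_norm_square_tail[OF t]
    by (subst nn_integral_cmult) (auto simp: ennreal_mult' [symmetric])
  finally show ?thesis by (simp add: measure_def)
qed

lemma std_complex_gaussian_cmod_square_cdf:
  assumes "prob_space M" and z: "std_complex_gaussian M z" and t: "0 \<le> t"
  shows "measure M {\<omega> \<in> space M. (cmod (z \<omega>))\<^sup>2 \<le> t} = 1 - exp (- t)"
proof -
  interpret prob_space M by fact
  have [measurable]: "(\<lambda>\<omega>. Re (z \<omega>)) \<in> borel_measurable M" "(\<lambda>\<omega>. Im (z \<omega>)) \<in> borel_measurable M"
    using z by (auto simp: std_complex_gaussian_def distributed_def)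
  have "{\<omega> \<in> space M. t < (cmod (z \<omega>))\<^sup>2} \<in> events"
    unfolding cmod_def by measurable
  moreover have "{\<omega> \<in> space M. (cmod (z \<omega>))\<^sup>2 \<le> t} = space M - {\<omega> \<in> space M. t < (cmod (z \<omega>))\<^sup>2}"
    by auto
  ultimately show ?thesis
    using std_complex_gaussian_cmod_square_tail[OF assms] by (simp add: prob_compl)
qed

lemma bessel_J0_0: "bessel_J0 0 = 1"
proof -
  have "bessel_J0 0 = (\<Sum>m\<in>{0}. (-1) ^ m / (fact m)\<^sup>2 * (0 / 2 :: real) ^ (2 * m))"
    unfolding bessel_J0_def by (rule suminf_finite) auto
  then show ?thesis by simp
qed

lemma jakes_leading_eigenvalue_pos:
  assumes N: "0 < N" and eig: "ordered_eigendecomposition N (jakes_matrix N W) U lam"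
  shows "0 < lam 0"
proof (rule ccontr)
  assume "\<not> 0 < lam 0"
  \<comment> \<open>Every eigenvalue is squeezed between 0 and \<open>lam 0\<close>, so the whole
    spectrum vanishes.\<close>
  then have "lam i = 0" if "i < N" for i
    using eig that unfolding ordered_eigendecomposition_def by (meson le0 order.antisym not_less order.trans)
  then have "mat_diag N (\<lambda>i. complex_of_real (lam i)) = 0\<^sub>m N N"
    by (intro eq_matI) (auto simp: mat_diag_def)
  moreover have U: "U \<in> carrier_mat N N" and "map_mat complex_of_real (jakes_matrix N W) =
      U * mat_diag N (\<lambda>i. complex_of_real (lam i)) * mat_adjoint U"
    using eig by (auto simp: ordered_eigendecomposition_def unitary_matrix_def)
  moreover have "mat_adjoint U \<in> carrier_mat N N"
    using U by (auto simp: mat_adjoint_def)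
  ultimately have "map_mat complex_of_real (jakes_matrix N W) $$ (0, 0) = 0"
    using N by simp
  then show False
    \<comment> \<open>The same entry lies on the diagonal, where the Bessel argument is 0 and the
      value is 1.\<close>
    using N by (simp add: jakes_matrix_def bessel_J0_0)
qed

text \<open>If column \<open>j\<close> vanished, so would the diagonal entry \<open>(j, j)\<close>
  of \<open>mat_adjoint U * U\<close>, which is 1.\<close>

lemma unitary_matrix_column_nonzero:
  assumes "unitary_matrix N U" and "j < N"
  shows "\<exists>n<N. U $$ (n, j) \<noteq> 0"
proof (rule ccontr)
  assume *: "\<not> (\<exists>n<N. U $$ (n, j) \<noteq> 0)"
  have U: "U \<in> carrier_mat N N" and unit: "mat_adjoint U * U = 1\<^sub>m N"
    using assms by (auto simp: unitary_matrix_def)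
  have adj: "mat_adjoint U \<in> carrier_mat N N"
    using U by (auto simp: mat_adjoint_def)
  have "col U j = 0\<^sub>v N"
    using * U \<open>j < N\<close> by (intro eq_vecI) auto
  then have "(mat_adjoint U * U) $$ (j, j) = 0"
    using U adj \<open>j < N\<close> by (simp add: scalar_prod_right_zero[OF row_carrier_vec])
  with unit \<open>j < N\<close> show False by simp
qed

text \<open>All branches share the single random factor \<open>(cmod (z \<omega>))\<^sup>2\<close>,
  so the maximum over \<open>n\<close> only acts on the deterministic weights and produces
  \<open>c1\<close>.\<close>

lemma rank1_F_max_eq:
  assumes N: "0 < N" and "0 < \<eta>" and lam: "0 < lam 0"
    and c1: "c1 = (MAX n\<in>{..<N}. (cmod (U $$ (n, 0)))\<^sup>2)" and "0 < c1"
  shows "rank1_F_max M N \<eta> lam U z x =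
    measure M {\<omega> \<in> space M. (cmod (z \<omega>))\<^sup>2 \<le> x / (lam 0 * c1)}"
proof -
  have fin: "finite {..<N}" and ne: "{..<N} \<noteq> {}"
    using N by auto
  have "(MAX n\<in>{..<N}. (cmod (rank1_channel \<eta> lam U z n \<omega>))\<^sup>2 / \<eta>) = lam 0 * c1 * (cmod (z \<omega>))\<^sup>2" for \<omega>
  proof -
    have "(cmod (rank1_channel \<eta> lam U z n \<omega>))\<^sup>2 / \<eta> =
        lam 0 * (cmod (z \<omega>))\<^sup>2 * (cmod (U $$ (n, 0)))\<^sup>2" for n
      using \<open>0 < \<eta>\<close> lam by (simp add: rank1_channel_def norm_mult power_mult_distrib)
    \<comment> \<open>Multiplication by the common nonnegative factor is monotone and hence commutes
      with \<open>Max\<close>.\<close>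
    moreover have "mono (\<lambda>y. lam 0 * (cmod (z \<omega>))\<^sup>2 * y)"
      using lam by (intro monoI mult_left_mono) auto
    from mono_Max_commute[OF this, of "(\<lambda>n. (cmod (U $$ (n, 0)))\<^sup>2) ` {..<N}"]
    have "(MAX n\<in>{..<N}. lam 0 * (cmod (z \<omega>))\<^sup>2 * (cmod (U $$ (n, 0)))\<^sup>2) = lam 0 * (cmod (z \<omega>))\<^sup>2 * c1"
      using fin ne by (simp add: c1 image_image)
    ultimately show ?thesis by (simp add: mult_ac)
  qed
  then show ?thesis
    using lam \<open>0 < c1\<close> by (simp add: rank1_F_max_def pos_le_divide_eq mult_ac)
qed

theorem mainTheorem5:
  fixes N :: nat and W \<eta> :: real
    and U :: "complex mat" and lam :: "nat \<Rightarrow> real"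
    and M :: "'a measure" and z1 :: "'a \<Rightarrow> complex" and c1 :: real
  assumes "N \<ge> 2" and "W > 0" and "\<eta> > 0"
    and "ordered_eigendecomposition N (jakes_matrix N W) U lam"
    and "prob_space M" and "std_complex_gaussian M z1"
    and "c1 = (MAX n\<in>{..<N}. (cmod (U $$ (n, 0)))\<^sup>2)"
  shows "(\<forall>x\<ge>0. rank1_F_max M N \<eta> lam U z1 x = 1 - exp (- x / (lam 0 * c1))) \<and>
         (\<forall>\<gamma>_th>0. \<forall>\<gamma>_avg>0.
            rank1_P_out M N \<eta> lam U z1 \<gamma>_th \<gamma>_avg = 1 - exp (- (\<gamma>_th / (\<gamma>_avg * lam 0 * c1))))"
proof -
  have N: "0 < N"
    using assms(1) by simp
  have lam: "0 < lam 0"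
    using jakes_leading_eigenvalue_pos[OF N assms(4)] .
  have "unitary_matrix N U"
    using assms(4) by (simp add: ordered_eigendecomposition_def)
  then obtain n where "n < N" "U $$ (n, 0) \<noteq> 0"
    using unitary_matrix_column_nonzero[OF _ N] by blast
  \<comment> \<open>A maximum is positive as soon as one member is, here the nonzero entry of the
    leading column.\<close>
  then have c1: "0 < c1"
    unfolding assms(7) by (subst Max_gr_iff) auto
  have F: "rank1_F_max M N \<eta> lam U z1 x = 1 - exp (- x / (lam 0 * c1))" if "0 \<le> x" for x
    using that lam c1
    by (simp add: rank1_F_max_eq[of N \<eta> lam c1 U, OF N assms(3) lam assms(7) c1]
        std_complex_gaussian_cmod_square_cdf[OF assms(5,6)])
  then show ?thesis
    by (auto simp: rank1_P_out_def mult.assoc)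
qed

end
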